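(* Let $\phi:\mathbb{R}\to\mathbb{R}\cup\{+\infty\}$ be a closed convex function such that $\phi(z)\ge\phi(1)=0$ for $z\ge 0$, $\phi(z)=+\infty$ for $z<0$, and $\phi$ is twice continuously differentiable around $z=1$ with $\phi''(1)>0$. Let $f:\mathbb{R}^d\times\mathbb{R}^l\to\mathbb{R}$ be a reward function, let $x\in\mathbb{R}^d$ be a decision, let $Y_1,\dots,Y_n\in\mathbb{R}^l$ be data, and let $\mathbb{P}_n=[p_1^n,\dots,p_n^n]$ be the associated empirical distribution ($p_i^n=1/n$). Let $\{\mathbb{Q}(\delta):\delta\ge 0\}$ be the family of worst-case measures defined by $\mathbb{Q}(0):=\mathbb{P}_n$ and, for $\delta>0$, $$\mathbb{Q}(\delta):=\arg\min_{\mathbb{Q}}\Big\{\sum_{i=1}^n q_i f(x,Y_i)+\frac1\delta\sum_{i=1}^n p_i^n\,\phi\Big(\frac{q_i}{p_i^n}\Big)\Big\},$$ where the minimum is over probability vectors $\mathbb{Q}=[q_1,\dots,q_n]$. Then the worst-case sensitivity $$\mathcal{S}_{\mathbb{P}_n}(f(x,Y)):=-\lim_{\delta\downarrow 0}\frac{\mathbb{E}_{\mathbb{Q}(\delta)}[f(x,Y)]-\mathbb{E}_{\mathbb{P}_n}[f(x,Y)]}{\delta}$$ satisfies $$\mathcal{S}_{\mathbb{P}_n}(f(x,Y))=\frac{1}{\phi''(1)}\,\mathbb{V}_{\mathbb{P}_n}[f(x,Y)].$$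
   Context: A probability vector $\mathbb{Q}=[q_1,\dots,q_n]$ ($q_i\ge 0$, $\sum_i q_i=1$) is identified with the distribution putting mass $q_i$ on the data point $Y_i$, so $\mathbb{E}_{\mathbb{Q}}[f(x,Y)]=\sum_{i=1}^n q_i f(x,Y_i)$. In particular $\mathbb{E}_{\mathbb{P}_n}[f(x,Y)]=\frac1n\sum_{i=1}^n f(x,Y_i)$, and $\mathbb{V}_{\mathbb{P}_n}[f(x,Y)]=\frac1n\sum_{i=1}^n\big(f(x,Y_i)-\mathbb{E}_{\mathbb{P}_n}[f(x,Y)]\big)^2$. *)

theory Defs
  imports "HOL-Analysis.Analysis"
begin

definition ereal_epigraph :: "('a \<Rightarrow> ereal) \<Rightarrow> ('a \<times> real) set" where
  "ereal_epigraph \<phi> = {(z, t). \<phi> z \<le> ereal t}"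

text \<open>Functions with values in the reals extended by plus infinity. Closed means closed
  epigraph, i.e. lower semicontinuous.\<close>

definition closed_convex_fun :: "('a::real_normed_vector \<Rightarrow> ereal) \<Rightarrow> bool" where
  "closed_convex_fun \<phi> \<longleftrightarrow> (\<forall>z. \<phi> z \<noteq> -\<infinity>) \<and> convex (ereal_epigraph \<phi>) \<and> closed (ereal_epigraph \<phi>)"

text \<open>\<^term>\<open>real_of_ereal\<close> sends infinite values to 0, so finiteness near the point is required
  explicitly.\<close>

definition C2_around :: "(real \<Rightarrow> ereal) \<Rightarrow> real \<Rightarrow> bool" where
  "C2_around \<phi> a \<longleftrightarrow> (\<exists>e>0.
     (\<forall>z\<in>ball a e. \<bar>\<phi> z\<bar> \<noteq> \<infinity>
        \<and> (\<lambda>z. real_of_ereal (\<phi> z)) differentiable (at z)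
        \<and> deriv (\<lambda>z. real_of_ereal (\<phi> z)) differentiable (at z))
     \<and> continuous_on (ball a e) (deriv (deriv (\<lambda>z. real_of_ereal (\<phi> z)))))"

definition second_deriv :: "(real \<Rightarrow> ereal) \<Rightarrow> real \<Rightarrow> real" where
  "second_deriv \<phi> = deriv (deriv (\<lambda>z. real_of_ereal (\<phi> z)))"

text \<open>Data points are indexed by a finite type \<open>'n\<close>, so that the sample size is \<open>CARD('n)\<close>;
  \<open>Z i\<close> below stands for the reward \<open>f x (Y i)\<close>.\<close>

definition prob_vectors :: "(real ^ 'n) set" where
  "prob_vectors = {q. (\<forall>i. 0 \<le> q $ i) \<and> (\<Sum>i\<in>UNIV. q $ i) = 1}"

definition empirical :: "real ^ 'n" where
  "empirical = (\<chi> i. 1 / real CARD('n))"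

definition pv_expectation :: "real ^ 'n \<Rightarrow> ('n \<Rightarrow> real) \<Rightarrow> real" where
  "pv_expectation q Z = (\<Sum>i\<in>UNIV. q $ i * Z i)"

definition pv_variance :: "real ^ 'n \<Rightarrow> ('n \<Rightarrow> real) \<Rightarrow> real" where
  "pv_variance q Z = pv_expectation q (\<lambda>i. (Z i - pv_expectation q Z)\<^sup>2)"

definition penalized_objective ::
    "(real \<Rightarrow> ereal) \<Rightarrow> ('n \<Rightarrow> real) \<Rightarrow> real \<Rightarrow> real ^ 'n \<Rightarrow> ereal" where
  "penalized_objective \<phi> Z \<delta> q =
     ereal (pv_expectation q Z)
     + ereal (1 / \<delta>) * (\<Sum>i\<in>UNIV. ereal (empirical $ i) * \<phi> (q $ i / empirical $ i))"

text \<open>The minimizer is unique for small \<open>\<delta>\<close>, but need not be for large \<open>\<delta>\<close>; a family is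
  therefore any selection of minimizers.\<close>

definition worst_case_family ::
    "(real \<Rightarrow> ereal) \<Rightarrow> ('n \<Rightarrow> real) \<Rightarrow> (real \<Rightarrow> real ^ 'n) \<Rightarrow> bool" where
  "worst_case_family \<phi> Z Q \<longleftrightarrow> Q 0 = empirical \<and>
     (\<forall>\<delta>>0. is_arg_min (penalized_objective \<phi> Z \<delta>) (\<lambda>q. q \<in> prob_vectors) (Q \<delta>))"

definition sensitivity_quotient ::
    "('n \<Rightarrow> real) \<Rightarrow> (real \<Rightarrow> real ^ 'n) \<Rightarrow> real \<Rightarrow> real" where
  "sensitivity_quotient Z Q \<delta> = (pv_expectation (Q \<delta>) Z - pv_expectation empirical Z) / \<delta>"

text \<open>\<^const>\<open>Lim\<close> is unspecified when the limit does not exist, so convergence has to be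
  asserted separately.\<close>

definition worst_case_sensitivity :: "('n \<Rightarrow> real) \<Rightarrow> (real \<Rightarrow> real ^ 'n) \<Rightarrow> real" where
  "worst_case_sensitivity Z Q = - Lim (at_right 0) (sensitivity_quotient Z Q)"

lemma penalized_objective_minimizer_exists:
  fixes Z :: "'n::finite \<Rightarrow> real"
  assumes closed: "closed_convex_fun \<phi>"
    and ge: "\<forall>z\<ge>0. \<phi> z \<ge> \<phi> 1" and one: "\<phi> 1 = 0" and neg: "\<forall>z<0. \<phi> z = \<infinity>" and "\<delta> > 0"
  shows "\<exists>q. is_arg_min (penalized_objective \<phi> Z \<delta>) (\<lambda>q. q \<in> prob_vectors) q"
proof -
  let ?N = "real CARD('n)"
  let ?obj = "penalized_objective \<phi> Z \<delta>"
  have N: "?N > 0" by simp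
  define F :: "(real^'n) \<times> (real^'n) \<Rightarrow> real" where
    "F = (\<lambda>(q, t). (\<Sum>i\<in>UNIV. q $ i * Z i) + 1 / \<delta> * (\<Sum>i\<in>UNIV. 1 / ?N * t $ i))"
  define E :: "((real^'n) \<times> (real^'n)) set" where
    "E = {(q, t). q \<in> prob_vectors \<and> (\<forall>i. (q $ i * ?N, t $ i) \<in> ereal_epigraph \<phi>)}"
  define c where "c = F (empirical, 0)"
  define K where "K = E \<inter> {p. F p \<le> c}"
  have nn: "\<phi> z \<ge> 0" for z
    using ge one neg by (cases "z < 0") auto
  have contF: "continuous_on S F" for S
    unfolding F_def case_prod_beta by (intro continuous_intros)
  have obj: "?obj q = ereal (\<Sum>i\<in>UNIV. q $ i * Z i)
      + ereal (1 / \<delta>) * (\<Sum>i\<in>UNIV. ereal (1 / ?N) * \<phi> (q $ i * ?N))" for q :: "real^'n"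
    by (simp add: penalized_objective_def pv_expectation_def empirical_def)
  have upper: "?obj q \<le> ereal (F (q, t))" if "(q, t) \<in> E" for q t
  proof -
    have "(\<Sum>i\<in>UNIV. ereal (1 / ?N) * \<phi> (q $ i * ?N)) \<le> (\<Sum>i\<in>UNIV. ereal (1 / ?N * t $ i))"
    proof (rule sum_mono)
      fix i
      have "\<phi> (q $ i * ?N) \<le> ereal (t $ i)"
        using that by (auto simp: E_def ereal_epigraph_def)
      then have "ereal (1 / ?N) * \<phi> (q $ i * ?N) \<le> ereal (1 / ?N) * ereal (t $ i)"
        by (intro ereal_mult_left_mono) auto
      then show "ereal (1 / ?N) * \<phi> (q $ i * ?N) \<le> ereal (1 / ?N * t $ i)" by simp
    qed
    then have "ereal (1 / \<delta>) * (\<Sum>i\<in>UNIV. ereal (1 / ?N) * \<phi> (q $ i * ?N))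
        \<le> ereal (1 / \<delta>) * ereal (\<Sum>i\<in>UNIV. 1 / ?N * t $ i)"
      using \<open>\<delta> > 0\<close> by (intro ereal_mult_left_mono) auto
    then show ?thesis
      unfolding obj F_def by (auto simp flip: plus_ereal.simps(1) intro!: add_left_mono)
  qed
  have lower: "\<exists>t. (q, t) \<in> E \<and> ereal (F (q, t)) = ?obj q"
    if q: "q \<in> prob_vectors" and fin: "?obj q \<noteq> \<infinity>" for q
  proof -
    have f: "\<phi> (q $ i * ?N) \<noteq> \<infinity>" for i
    proof
      assume "\<phi> (q $ i * ?N) = \<infinity>"
      then have "ereal (1 / ?N) * \<phi> (q $ i * ?N) = \<infinity>" by simp
      then have "(\<Sum>i\<in>UNIV. ereal (1 / ?N) * \<phi> (q $ i * ?N)) = \<infinity>"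
        unfolding sum_Pinfty using finite_class.finite_UNIV by blast
      then show False using fin \<open>\<delta> > 0\<close> by (simp add: obj)
    qed
    define t :: "real^'n" where "t = (\<chi> i. real_of_ereal (\<phi> (q $ i * ?N)))"
    have t: "\<phi> (q $ i * ?N) = ereal (t $ i)" for i
      using f[of i] nn[of "q $ i * ?N"] by (cases "\<phi> (q $ i * ?N)") (auto simp: t_def)
    have "(q, t) \<in> E" using q t by (auto simp: E_def ereal_epigraph_def)
    moreover have "ereal (F (q, t)) = ?obj q"
      unfolding obj t F_def by simp
    ultimately show ?thesis by blast
  qed
  have closedE: "closed E"
  proof -
    have "E = {p. \<forall>i. 0 \<le> fst p $ i} \<inter> {p. (\<Sum>i\<in>UNIV. fst p $ i) = 1}
        \<inter> (\<Inter>i. (\<lambda>p. (fst p $ i * ?N, snd p $ i)) -` ereal_epigraph \<phi>)"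
      by (auto simp: E_def prob_vectors_def)
    moreover have "closed (ereal_epigraph \<phi>)"
      using closed by (simp add: closed_convex_fun_def)
    ultimately show ?thesis
      by (simp, intro closed_Int closed_Collect_all closed_Collect_le closed_Collect_eq
          closed_INT ballI closed_vimage continuous_intros)
  qed
  have bdd: "bounded K"
  proof -
    define B where "B = (\<Sum>i\<in>UNIV. \<bar>Z i\<bar>)"
    define M where "M = \<delta> * ?N * (\<bar>c\<bar> + B)"
    have qi: "\<bar>q $ i\<bar> \<le> 1" if "q \<in> prob_vectors" for q :: "real^'n" and i
      using that member_le_sum[of i UNIV "\<lambda>i. q $ i"] by (auto simp: prob_vectors_def)
    have ti: "\<bar>t $ i\<bar> \<le> M" if "(q, t) \<in> K" for q t i
    proof -
      have q: "q \<in> prob_vectors" and Fc: "F (q, t) \<le> c"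
        using that by (auto simp: K_def E_def)
      have t0: "0 \<le> t $ i" for i
      proof -
        have "\<phi> (q $ i * ?N) \<le> ereal (t $ i)"
          using that by (auto simp: K_def E_def ereal_epigraph_def)
        then show ?thesis using nn[of "q $ i * ?N"] by (metis ereal_less_eq(5) order_trans)
      qed
      have "\<bar>\<Sum>i\<in>UNIV. q $ i * Z i\<bar> \<le> B"
        unfolding B_def
        by (rule order_trans[OF sum_abs])
          (auto intro!: sum_mono simp: abs_mult mult_left_le_one_le qi[OF q])
      then have "1 / \<delta> * (\<Sum>i\<in>UNIV. 1 / ?N * t $ i) \<le> \<bar>c\<bar> + B"
        using Fc unfolding F_def by auto
      then have "(\<Sum>i\<in>UNIV. t $ i) \<le> M"
        using \<open>\<delta> > 0\<close> by (simp add: M_def field_simps flip: sum_divide_distrib)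
      moreover have "t $ i \<le> (\<Sum>i\<in>UNIV. t $ i)"
        by (rule member_le_sum) (auto simp: t0)
      ultimately show ?thesis using t0[of i] by simp
    qed
    have "K \<subseteq> cball 0 ?N \<times> cball 0 (?N * M)"
    proof (clarsimp)
      fix q t assume k: "(q, t) \<in> K"
      then have q: "q \<in> prob_vectors" by (auto simp: K_def E_def)
      have "norm q \<le> (\<Sum>i\<in>(UNIV::'n set). 1)"
        by (rule order_trans[OF norm_le_l1_cart sum_mono]) (rule qi[OF q])
      moreover have "norm t \<le> (\<Sum>i\<in>(UNIV::'n set). M)"
        by (rule order_trans[OF norm_le_l1_cart sum_mono]) (rule ti[OF k])
      ultimately show "norm q \<le> ?N \<and> norm t \<le> ?N * M" by simp
    qed
    then show ?thesis
      by (rule bounded_subset[OF bounded_Times[OF bounded_cball bounded_cball]])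
  qed
  have "closed K" unfolding K_def
    by (intro closed_Int closedE closed_Collect_le contF continuous_on_const)
  with bdd have "compact K" by (simp add: compact_eq_bounded_closed)
  moreover have inK: "(empirical, 0) \<in> K"
    using one
    by (auto simp: K_def E_def c_def empirical_def prob_vectors_def ereal_epigraph_def)
  ultimately obtain p where p: "p \<in> K" "\<And>y. y \<in> K \<Longrightarrow> F p \<le> F y"
    using continuous_attains_inf[of K F] contF by blast
  obtain q t where qt: "p = (q, t)" by (cases p)
  have "\<not> ?obj y < ?obj q" if y: "y \<in> prob_vectors" for y
  proof
    assume less: "?obj y < ?obj q"
    then have "?obj y \<noteq> \<infinity>" by auto
    then obtain s where s: "(y, s) \<in> E" "ereal (F (y, s)) = ?obj y"
      using lower[OF y] by auto
    have "?obj q \<le> ereal (F p)" using upper[of q t] p qt by (auto simp: K_def)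
    with s less have lt: "F (y, s) < F p"
      by (metis less_ereal.simps(1) order_less_le_trans)
    also have "F p \<le> c" using p by (simp add: K_def)
    finally have "(y, s) \<in> K" using s by (simp add: K_def)
    then show False using p(2) lt by fastforce
  qed
  moreover have "q \<in> prob_vectors" using p qt by (auto simp: K_def E_def)
  ultimately show ?thesis unfolding is_arg_min_def by blast
qed

end

theory Submission
  imports Defs
begin

text \<open>Write \<open>q = (1 + \<delta> v) / n\<close> and \<open>W = Z - E Z\<close>. Since \<open>\<phi>(1 + h) = a h\<^sup>2 / 2 + o(h\<^sup>2)\<close> with
  \<open>a = \<phi>''(1)\<close>, the objective minus its value at the empirical measure, multiplied by \<open>n / \<delta>\<close>,
  is the strongly convex quadratic \<open>\<Sum>v W + a / 2 * \<Sum>v\<^sup>2\<close> up to \<open>o(1)\<close>, whose minimizer is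
  \<open>v = -W / a\<close>. Convexity of \<open>\<phi>\<close> forces the true minimizers into the region where the expansion
  holds, and comparing their value with that at \<open>v = -W / a\<close> shows that \<open>\<Sum>v W\<close> tends to
  \<open>-\<Sum>W\<^sup>2 / a\<close>.\<close>

text \<open>As a function of \<open>t\<close>, the remainder has derivative
  \<open>g' (a + t) - g' a - c * t\<close>. Differentiability of \<open>g'\<close> at
  \<open>a\<close> bounds this by \<open>\<epsilon> * \<bar>h\<bar>\<close> for
  \<open>\<bar>t\<bar> \<le> \<bar>h\<bar>\<close>, and the mean value inequality supplies the
  second factor \<open>\<bar>h\<bar>\<close>.\<close>

lemma second_order_expansion:
  fixes g g' :: "real \<Rightarrow> real"
  assumes "e > 0" and g: "\<And>z. z \<in> ball a e \<Longrightarrow> (g has_real_derivative g' z) (at z)"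
    and g': "(g' has_real_derivative c) (at a)" and "\<epsilon> > 0"
  shows "\<exists>r>0. \<forall>h. \<bar>h\<bar> \<le> r \<longrightarrow> \<bar>g (a + h) - g a - g' a * h - c / 2 * h\<^sup>2\<bar> \<le> \<epsilon> * h\<^sup>2"
proof -
  obtain d where d: "d > 0"
    "\<And>z. \<bar>z - a\<bar> < d \<Longrightarrow> \<bar>g' z - g' a - c * (z - a)\<bar> \<le> \<epsilon> * \<bar>z - a\<bar>"
    using g' \<open>\<epsilon> > 0\<close> unfolding has_field_derivative_def has_derivative_at_alt
    by (auto simp: mult.commute)
  \<comment> \<open>Halving keeps the closed interval of radius \<open>r\<close> strictly inside
    both open neighbourhoods.\<close>
  define r where "r = min d e / 2"
  have "r > 0" using d \<open>e > 0\<close> by (simp add: r_def)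
  moreover have "\<bar>g (a + h) - g a - g' a * h - c / 2 * h\<^sup>2\<bar> \<le> \<epsilon> * h\<^sup>2" if h: "\<bar>h\<bar> \<le> r" for h
  proof -
    define G where "G = (\<lambda>t. g (a + t) - g' a * t - c / 2 * t\<^sup>2)"
    have r: "r < d" "r < e" using d \<open>e > 0\<close> by (auto simp: r_def)
    have "norm (G h - G 0) \<le> (\<epsilon> * \<bar>h\<bar>) * norm (h - 0)"
    proof (rule field_differentiable_bound[where S = "cball 0 \<bar>h\<bar>"])
      fix t :: real assume "t \<in> cball 0 \<bar>h\<bar>"
      then have t: "\<bar>t\<bar> \<le> \<bar>h\<bar>" by simp
      then have "a + t \<in> ball a e" using h r by (auto simp: dist_real_def)
      note g[OF this]
      then have "((\<lambda>t. g (a + t)) has_real_derivative g' (a + t)) (at t)"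
        using DERIV_shift[of g "g' (a + t)" t a] by (simp add: add.commute)
      then have "(G has_real_derivative (g' (a + t) - g' a - c * t)) (at t)"
        unfolding G_def by (auto intro!: derivative_eq_intros)
      then show "(G has_real_derivative (g' (a + t) - g' a - c * t)) (at t within cball 0 \<bar>h\<bar>)"
        by (rule has_field_derivative_at_within)
      have "\<bar>g' (a + t) - g' a - c * t\<bar> \<le> \<epsilon> * \<bar>t\<bar>" using d(2)[of "a + t"] t h r by simp
      also have "\<dots> \<le> \<epsilon> * \<bar>h\<bar>" using t \<open>\<epsilon> > 0\<close> by simp
      finally show "norm (g' (a + t) - g' a - c * t) \<le> \<epsilon> * \<bar>h\<bar>" by simp
    qed auto
    then show ?thesis
      by (simp add: G_def power2_eq_square algebra_simps flip: abs_mult)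
  qed
  ultimately show ?thesis by blast
qed

text \<open>The convex epigraph contains the segment from \<open>(a, 0)\<close> to
  \<open>(a + h, t)\<close>. The bound serves to pull a point far from \<open>a\<close> back to
  where the expansion of \<open>\<phi>\<close> holds.\<close>

lemma closed_convex_fun_contract:
  assumes "closed_convex_fun \<phi>" and "\<phi> a = 0" and "\<phi> (a + h) \<le> ereal t"
    and "0 \<le> s" "s \<le> 1"
  shows "\<phi> (a + s *\<^sub>R h) \<le> ereal (s * t)"
proof -
  have "(1 - s) *\<^sub>R (a, 0) + s *\<^sub>R (a + h, t) \<in> ereal_epigraph \<phi>"
    using assms by (intro convexD) (auto simp: closed_convex_fun_def ereal_epigraph_def zero_ereal_def)
  then show ?thesis by (simp add: ereal_epigraph_def algebra_simps)
qed

text \<open>Stability of the minimizer by completing the square. With \<open>D\<close> the squared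
  distance of \<open>v\<close> from \<open>- W / a\<close> and \<open>V\<close> that from 0, the
  hypothesis says \<open>a / 2 * D \<le> \<epsilon> * (V + S / a^2)\<close>. As
  \<open>V \<le> 2 * D + 2 * S / a^2\<close> and \<open>\<epsilon> \<le> a / 8\<close>, the left
  side absorbs the \<open>D\<close> on the right; Cauchy-Schwarz then passes from \<open>D\<close>
  to the pairing with \<open>W\<close>.\<close>

lemma near_minimizer_of_quadratic:
  fixes v W :: "'n::finite \<Rightarrow> real"
  defines "S \<equiv> \<Sum>i\<in>UNIV. (W i)\<^sup>2"
  assumes a: "a > 0" and \<epsilon>: "\<epsilon> > 0" "\<epsilon> \<le> a / 8"
    and le: "(\<Sum>i\<in>UNIV. v i * W i) + (a / 2 - \<epsilon>) * (\<Sum>i\<in>UNIV. (v i)\<^sup>2)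
      \<le> - S / (2 * a) + \<epsilon> * S / a\<^sup>2"
  shows "((\<Sum>i\<in>UNIV. v i * W i) + S / a)\<^sup>2 \<le> 12 * \<epsilon> * S\<^sup>2 / a ^ 3"
proof -
  define s where "s = (\<Sum>i\<in>UNIV. v i * W i)"
  define V where "V = (\<Sum>i\<in>UNIV. (v i)\<^sup>2)"
  define D where "D = (\<Sum>i\<in>UNIV. (v i + W i / a)\<^sup>2)"
  have S0: "S \<ge> 0" unfolding S_def by (simp add: sum_nonneg)
  have D0: "D \<ge> 0" unfolding D_def by (simp add: sum_nonneg)
  have D: "D = V + 2 * s / a + S / a\<^sup>2"
    by (simp add: D_def V_def s_def S_def power2_sum power_divide sum.distrib sum_distrib_left
        sum_divide_distrib mult.assoc)
  have "V \<le> (\<Sum>i\<in>UNIV. 2 * (v i + W i / a)\<^sup>2 + 2 * (W i / a)\<^sup>2)"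
    unfolding V_def
  proof (rule sum_mono)
    \<comment> \<open>The right side minus the left side is the square of
      \<open>v i + 2 * (W i / a)\<close>.\<close>
    fix i show "(v i)\<^sup>2 \<le> 2 * (v i + W i / a)\<^sup>2 + 2 * (W i / a)\<^sup>2"
      using zero_le_power2[of "v i + 2 * (W i / a)"] by (simp add: power2_eq_square algebra_simps)
  qed
  also have "\<dots> = 2 * D + 2 * (S / a\<^sup>2)"
    by (simp add: D_def S_def sum.distrib sum_distrib_left sum_divide_distrib power_divide)
  finally have V: "V \<le> 2 * D + 2 * (S / a\<^sup>2)" .
  have "a / 2 * D = s + a / 2 * V + S / (2 * a)"
    using a by (simp add: D field_simps power2_eq_square)
  also have "\<dots> \<le> \<epsilon> * (V + S / a\<^sup>2)"
    using le by (simp add: s_def V_def algebra_simps)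
  also have "\<dots> \<le> \<epsilon> * (2 * D + 3 * (S / a\<^sup>2))" using V \<epsilon> by (intro mult_left_mono) auto
  also have "\<dots> \<le> a / 4 * D + 3 * \<epsilon> * (S / a\<^sup>2)"
    using mult_right_mono[OF \<epsilon>(2) D0] by (simp add: algebra_simps)
  finally have "a * D \<le> 12 * \<epsilon> * (S / a\<^sup>2)" by linarith
  then have D_le: "D \<le> 12 * \<epsilon> * S / a ^ 3"
    using a by (simp add: field_simps power2_eq_square power3_eq_cube)
  have "s + S / a = (\<Sum>i\<in>UNIV. W i * (v i + W i / a))"
    by (simp add: s_def S_def sum.distrib sum_divide_distrib algebra_simps power2_eq_square)
  then have "(s + S / a)\<^sup>2 \<le> S * D"
    unfolding S_def D_def by (simp add: Cauchy_Schwarz_ineq_sum)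
  also have "\<dots> \<le> S * (12 * \<epsilon> * S / a ^ 3)" using D_le S0 by (rule mult_left_mono)
  finally show ?thesis by (simp add: s_def power2_eq_square algebra_simps)
qed

text \<open>The centred rewards \<open>Z i - m\<close> sum to 0, so adding their sum turns the
  factor \<open>q $ i * n - 1\<close>, with \<open>n\<close> the sample size, into
  \<open>q $ i * n\<close> at no cost.\<close>

lemma pv_expectation_deviation:
  fixes q :: "real ^ 'n::finite" and Z :: "'n \<Rightarrow> real"
  assumes "q \<in> prob_vectors"
  defines "m \<equiv> pv_expectation empirical Z"
  shows "pv_expectation q Z
    = m + 1 / real CARD('n) * (\<Sum>i\<in>UNIV. (q $ i * real CARD('n) - 1) * (Z i - m))"
proof -
  have "(\<Sum>i\<in>UNIV. Z i - m) = 0"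
    by (simp add: sum_subtractf m_def pv_expectation_def empirical_def flip: sum_divide_distrib)
  then have "(\<Sum>i\<in>UNIV. (q $ i * real CARD('n) - 1) * (Z i - m))
      = (\<Sum>i\<in>UNIV. (q $ i * real CARD('n) - 1) * (Z i - m)) + (\<Sum>i\<in>UNIV. Z i - m)" by simp
  also have "\<dots> = real CARD('n) * (\<Sum>i\<in>UNIV. q $ i * (Z i - m))"
    unfolding sum_distrib_left sum.distrib[symmetric] by (simp add: algebra_simps)
  also have "(\<Sum>i\<in>UNIV. q $ i * (Z i - m)) = pv_expectation q Z - m"
    using assms(1) by (simp add: right_diff_distrib sum_subtractf pv_expectation_def prob_vectors_def
        flip: sum_distrib_right)
  finally show ?thesis by simp
qed

text \<open>When \<open>\<phi>\<close> is finite at every ratio, the extended-real objective is a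
  real number, so that minimizers can be compared by real arithmetic.\<close>

lemma penalized_objective_deviation:
  fixes q :: "real ^ 'n::finite" and Z :: "'n \<Rightarrow> real"
  assumes "q \<in> prob_vectors" and "\<And>i. \<phi> (q $ i * real CARD('n)) = ereal (p i)"
  defines "m \<equiv> pv_expectation empirical Z"
  shows "penalized_objective \<phi> Z \<delta> q = ereal (m + 1 / real CARD('n) *
    ((\<Sum>i\<in>UNIV. (q $ i * real CARD('n) - 1) * (Z i - m)) + 1 / \<delta> * (\<Sum>i\<in>UNIV. p i)))"
  using assms(2) pv_expectation_deviation[OF assms(1), of Z]
  by (simp add: penalized_objective_def empirical_def m_def distrib_left
      flip: sum_divide_distrib)

lemma sensitivity_quotient_tendsto:
  fixes Z :: "'n::finite \<Rightarrow> real"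
  assumes conv: "closed_convex_fun \<phi>" and ge: "\<forall>z\<ge>0. \<phi> z \<ge> \<phi> 1" and one: "\<phi> 1 = 0"
    and neg: "\<forall>z<0. \<phi> z = \<infinity>" and C2: "C2_around \<phi> 1" and pos: "second_deriv \<phi> 1 > 0"
    and Q: "worst_case_family \<phi> Z Q"
  shows "(sensitivity_quotient Z Q \<longlongrightarrow> - (1 / second_deriv \<phi> 1 * pv_variance empirical Z))
    (at_right 0)"
proof -
  define N where "N = real CARD('n)"
  define a where "a = second_deriv \<phi> 1"
  define m where "m = pv_expectation empirical Z"
  define W where "W i = Z i - m" for i
  define S where "S = (\<Sum>i\<in>UNIV. (W i)\<^sup>2)"
  define B where "B = (\<Sum>i\<in>UNIV. \<bar>W i\<bar>)"
  \<comment> \<open>\<open>g\<close> takes the default value 0 where \<open>\<phi>\<close> is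
    infinite. It is thus nonnegative everywhere, but replaces \<open>\<phi>\<close> only where
    finiteness is known.\<close>
  define g where "g z = real_of_ereal (\<phi> z)" for z
  \<comment> \<open>The relative deviation of a weight from \<open>1 / N\<close>: the argument of
    \<open>\<phi>\<close> in the objective is \<open>1 + dev q i\<close>.\<close>
  define dev where "dev q i = q $ i * N - 1" for q :: "real ^ 'n" and i
  have N: "N > 0" by (simp add: N_def)
  have a: "a > 0" using pos by (simp add: a_def)
  have WB: "\<bar>W i\<bar> \<le> B" for i unfolding B_def by (rule member_le_sum) auto
  have W0: "(\<Sum>i\<in>UNIV. W i) = 0"
    by (simp add: W_def sum_subtractf m_def pv_expectation_def empirical_def
        flip: sum_divide_distrib)
  have var: "pv_variance empirical Z = S / N"
    by (simp add: pv_variance_def pv_expectation_def S_def W_def m_def N_def empirical_def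
        sum_divide_distrib)
  have nn: "\<phi> z \<ge> 0" for z
    using ge one neg by (cases "z < 0") auto
  then have g0: "g z \<ge> 0" for z by (simp add: g_def real_of_ereal_pos)
  have phi_g: "\<phi> z = ereal (g z)" if "\<phi> z \<noteq> \<infinity>" for z
    using that nn[of z] by (cases "\<phi> z") (auto simp: g_def)
  have g1: "g 1 = 0" by (simp add: g_def one)

  \<comment> \<open>Derivatives of the penalty function at 1\<close>
  obtain e where e: "e > 0" and fin: "\<And>z. z \<in> ball 1 e \<Longrightarrow> \<phi> z \<noteq> \<infinity>"
    and dg: "\<And>z. z \<in> ball 1 e \<Longrightarrow> g differentiable (at z)"
    and ddg: "\<And>z. z \<in> ball 1 e \<Longrightarrow> deriv g differentiable (at z)"
    using C2 unfolding C2_around_def g_def[abs_def] by fastforce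
  have g': "(g has_real_derivative deriv g z) (at z)" if "z \<in> ball 1 e" for z
    using dg[OF that] by (simp add: DERIV_deriv_iff_real_differentiable)
  have g'': "(deriv g has_real_derivative a) (at 1)"
    using ddg[of 1] e
    by (simp add: a_def second_deriv_def DERIV_deriv_iff_real_differentiable flip: g_def)
  \<comment> \<open>The point 1 minimizes \<open>g\<close>, so the expansion there has no linear
    term.\<close>
  have g'1: "deriv g 1 = 0"
    by (rule DERIV_local_min[OF g' e]) (use e g0 g1 in auto)

  \<comment> \<open>The objective in terms of deviations\<close>
  have q01: "0 \<le> q $ i" "q $ i \<le> 1" if "q \<in> prob_vectors" for q :: "real ^ 'n" and i
    using that member_le_sum[of i UNIV "\<lambda>i. q $ i"] by (auto simp: prob_vectors_def)
  have obj: "penalized_objective \<phi> Z \<delta> q = ereal (m + 1 / N *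
      ((\<Sum>i\<in>UNIV. dev q i * W i) + 1 / \<delta> * (\<Sum>i\<in>UNIV. g (1 + dev q i))))"
    if "q \<in> prob_vectors" "\<And>i. \<phi> (1 + dev q i) \<noteq> \<infinity>" for q \<delta>
    using penalized_objective_deviation[OF that(1), of \<phi> "\<lambda>i. g (1 + dev q i)" Z \<delta>]
      phi_g[OF that(2)] by (simp add: dev_def m_def W_def N_def)

  have opt: "Q \<delta> \<in> prob_vectors"
    "\<And>y. y \<in> prob_vectors \<Longrightarrow> penalized_objective \<phi> Z \<delta> (Q \<delta>) \<le> penalized_objective \<phi> Z \<delta> y"
    if "\<delta> > 0" for \<delta>
    using Q that unfolding worst_case_family_def is_arg_min_def by (auto simp: not_less)
  have emp: "empirical \<in> (prob_vectors :: (real ^ 'n) set)"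
    by (simp add: prob_vectors_def empirical_def)
  have dev_emp: "dev empirical i = 0" for i
    by (simp add: dev_def empirical_def N_def)
  \<comment> \<open>An infinite penalty would lose against the empirical measure, whose objective
    value is finite.\<close>
  have finQ: "\<phi> (1 + dev (Q \<delta>) i) \<noteq> \<infinity>" if \<delta>: "\<delta> > 0" for \<delta> i
  proof
    assume "\<phi> (1 + dev (Q \<delta>) i) = \<infinity>"
    then have "ereal (1 / N) * \<phi> (Q \<delta> $ i * N) = \<infinity>" using N by (simp add: dev_def)
    then have "(\<Sum>i\<in>UNIV. ereal (1 / N) * \<phi> (Q \<delta> $ i * N)) = \<infinity>"
      unfolding sum_Pinfty using finite_class.finite_UNIV by blast
    then have "penalized_objective \<phi> Z \<delta> (Q \<delta>) = \<infinity>"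
      using \<delta> by (simp add: penalized_objective_def empirical_def N_def)
    then show False
      using opt(2)[OF \<delta> emp] obj[OF emp, of \<delta>] by (simp add: dev_emp one)
  qed
  have compare: "(\<Sum>i\<in>UNIV. dev (Q \<delta>) i * W i) + 1 / \<delta> * (\<Sum>i\<in>UNIV. g (1 + dev (Q \<delta>) i))
      \<le> (\<Sum>i\<in>UNIV. dev y i * W i) + 1 / \<delta> * (\<Sum>i\<in>UNIV. g (1 + dev y i))"
    if "\<delta> > 0" "y \<in> prob_vectors" "\<And>i. \<phi> (1 + dev y i) \<noteq> \<infinity>" for \<delta> y
    using opt(2)[OF that(1,2)] N
    unfolding obj[OF opt(1)[OF that(1)] finQ[OF that(1)]] obj[OF that(2,3)]
    by (simp add: divide_le_cancel)

  \<comment> \<open>Quadratic estimate for small \<delta>\<close>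
  have small: "\<forall>\<^sub>F \<delta> in at_right 0. \<delta> * c < b" if "b > 0" for b c :: real
    by (rule order_tendstoD(2)[OF _ that]) (auto intro!: tendsto_eq_intros)

  \<comment> \<open>The scaled quotient \<open>N * sensitivity_quotient Z Q \<delta>\<close> is the
    sum of \<open>v i * W i\<close>, whose expected limit is \<open>- S / a\<close>. The accuracy
    \<open>\<epsilon>\<close> stays fixed while \<delta> tends to 0.\<close>
  have key: "\<forall>\<^sub>F \<delta> in at_right 0.
      (N * sensitivity_quotient Z Q \<delta> + S / a)\<^sup>2 \<le> 12 * \<epsilon> * S\<^sup>2 / a ^ 3"
    if \<epsilon>: "\<epsilon> > 0" "\<epsilon> \<le> a / 8" for \<epsilon>
  proof -
    obtain r0 where r0: "r0 > 0" "\<And>h. \<bar>h\<bar> \<le> r0 \<Longrightarrow> \<bar>g (1 + h) - a / 2 * h\<^sup>2\<bar> \<le> \<epsilon> * h\<^sup>2"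
      using second_order_expansion[OF e g' g'' \<epsilon>(1)] g1 g'1 by auto
    \<comment> \<open>The bound \<open>r0\<close> gives the expansion, \<open>e / 2\<close> gives
      finiteness, and 1 keeps the weights of the competitor \<open>y\<close> below
      nonnegative.\<close>
    define r where "r = min (min r0 (e / 2)) 1"
    have r: "r > 0" "r \<le> 1" "r < e" "r \<le> r0" using r0 e by (auto simp: r_def)
    have expand: "\<bar>g (1 + h) - a / 2 * h\<^sup>2\<bar> \<le> \<epsilon> * h\<^sup>2" if "\<bar>h\<bar> \<le> r" for h
      using r0(2)[of h] that r by simp
    have finr: "\<phi> (1 + h) \<noteq> \<infinity>" if "\<bar>h\<bar> \<le> r" for h
      using fin[of "1 + h"] that r by (auto simp: dist_real_def)
    \<comment> \<open>A lower bound for \<open>g\<close> at distance \<open>r\<close> from 1,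
      positive because \<open>\<epsilon> \<le> a / 8\<close>.\<close>
    define \<kappa> where "\<kappa> = (a / 2 - \<epsilon>) * r\<^sup>2"
    have "\<kappa> > 0" using r \<epsilon> a by (simp add: \<kappa>_def)
    \<comment> \<open>Convexity extends the bound outwards: \<open>k\<close> is \<open>h\<close>
      shrunk to length \<open>r\<close>, and contraction towards 1 does not increase
      \<open>g\<close>.\<close>
    have outside: "\<kappa> \<le> g (1 + h)" if h: "r \<le> \<bar>h\<bar>" and fh: "\<phi> (1 + h) \<noteq> \<infinity>" for h
    proof -
      define k where "k = r / \<bar>h\<bar> * h"
      have k: "\<bar>k\<bar> = r" using h r by (simp add: k_def abs_mult)
      have "\<phi> (1 + k) \<le> ereal (r / \<bar>h\<bar> * g (1 + h))"
        using closed_convex_fun_contract[OF conv one, of h "g (1 + h)" "r / \<bar>h\<bar>"] phi_g[OF fh] h r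
        by (simp add: k_def)
      then have "g (1 + k) \<le> r / \<bar>h\<bar> * g (1 + h)"
        using phi_g[OF finr[of k]] k by simp
      also have "\<dots> \<le> g (1 + h)"
        using h r g0[of "1 + h"] by (intro mult_left_le_one_le) auto
      finally have "g (1 + k) \<le> g (1 + h)" .
      moreover have "k\<^sup>2 = r\<^sup>2" using k by (metis power2_abs)
      ultimately show ?thesis using expand[of k] k by (simp add: \<kappa>_def left_diff_distrib)
    qed
    \<comment> \<open>The second condition confines the deviations of the minimizer to radius
      \<open>r\<close>, the third those of the competitor \<open>y\<close>.\<close>
    have "\<forall>\<^sub>F \<delta> in at_right 0. \<delta> > 0 \<and> \<delta> * (N * B) < \<kappa> \<and> \<delta> * (B / a) < r"
      by (intro eventually_conj eventually_at_right_less small \<open>\<kappa> > 0\<close> r(1))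
    then show ?thesis
    proof (rule eventually_mono)
      fix \<delta> :: real assume "\<delta> > 0 \<and> \<delta> * (N * B) < \<kappa> \<and> \<delta> * (B / a) < r"
      then have \<delta>: "\<delta> > 0" "\<delta> * (N * B) < \<kappa>" "\<delta> * (B / a) < r" by auto
      define u where "u = dev (Q \<delta>)"
      define v where "v i = u i / \<delta>" for i
      have uN: "\<bar>u i\<bar> \<le> N" for i
      proof -
        have "1 \<le> N" by (simp add: N_def Suc_leI)
        moreover have "0 \<le> Q \<delta> $ i * N" "Q \<delta> $ i * N \<le> N"
          using q01[OF opt(1)[OF \<delta>(1)], of i] N by (auto simp: mult_left_le_one_le)
        ultimately show ?thesis unfolding u_def dev_def by linarith
      qed
      have "- (\<Sum>i\<in>UNIV. u i * W i) \<le> \<bar>\<Sum>i\<in>UNIV. u i * W i\<bar>" by simp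
      also have "\<dots> \<le> (\<Sum>i\<in>UNIV. N * \<bar>W i\<bar>)"
        by (rule order_trans[OF sum_abs]) (auto intro!: sum_mono mult_right_mono uN simp: abs_mult)
      finally have lin: "- (\<Sum>i\<in>UNIV. u i * W i) \<le> N * B" by (simp add: B_def sum_distrib_left)
      \<comment> \<open>Comparison with the empirical measure, where both terms vanish. It bounds
        the total penalty by \<open>\<delta> * N * B < \<kappa>\<close>, while a single deviation
        beyond \<open>r\<close> would already cost \<open>\<kappa>\<close>.\<close>
      have "(\<Sum>i\<in>UNIV. u i * W i) + 1 / \<delta> * (\<Sum>i\<in>UNIV. g (1 + u i)) \<le> 0"
        using compare[OF \<delta>(1) emp] by (simp add: dev_emp one g1 u_def)
      then have "1 / \<delta> * (\<Sum>i\<in>UNIV. g (1 + u i)) \<le> N * B" using lin by linarith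
      then have tot: "(\<Sum>i\<in>UNIV. g (1 + u i)) < \<kappa>"
        using \<delta> by (simp add: field_simps)
      have ur: "\<bar>u i\<bar> \<le> r" for i
      proof (rule ccontr)
        assume "\<not> \<bar>u i\<bar> \<le> r"
        then have "\<kappa> \<le> g (1 + u i)" using outside finQ[OF \<delta>(1)] by (simp add: u_def)
        also have "\<dots> \<le> (\<Sum>i\<in>UNIV. g (1 + u i))" by (rule member_le_sum) (auto simp: g0)
        finally show False using tot by simp
      qed

      \<comment> \<open>The competitor is the minimizer \<open>- W / a\<close> of the limiting
        quadratic, scaled back by \<delta>. Its weights sum to 1 since \<open>W\<close> sums to
        0.\<close>
      define y :: "real ^ 'n" where "y = (\<chi> i. (1 - \<delta> * W i / a) / N)"
      have dev_y: "dev y i = - (\<delta> * W i / a)" for i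
        using N by (simp add: dev_def y_def)
      have yr: "\<bar>dev y i\<bar> \<le> r" for i
      proof -
        have "\<bar>dev y i\<bar> = \<delta> * (\<bar>W i\<bar> / a)" using \<delta>(1) a by (simp add: dev_y abs_mult)
        also have "\<dots> \<le> \<delta> * (B / a)"
          using \<delta>(1) a WB[of i] by (intro mult_left_mono divide_right_mono) auto
        finally show ?thesis using \<delta> by simp
      qed
      have "y \<in> prob_vectors"
      proof -
        have "\<delta> * W i / a \<le> 1" for i using yr[of i] r unfolding dev_y by linarith
        then have "0 \<le> y $ i" for i using N by (simp add: y_def)
        moreover have "(\<Sum>i\<in>UNIV. \<delta> * W i / a) = \<delta> * (\<Sum>i\<in>UNIV. W i) / a"
          by (simp add: sum_distrib_left sum_divide_distrib)
        then have "(\<Sum>i\<in>UNIV. y $ i) = 1"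
          by (simp add: y_def W0 sum_subtractf N_def flip: sum_divide_distrib)
        ultimately show ?thesis by (simp add: prob_vectors_def)
      qed
      note cmp = compare[OF \<delta>(1) this finr[OF yr]]
      have uv: "u i = \<delta> * v i" for i using \<delta> by (simp add: v_def)
      \<comment> \<open>The expansion is used from below at the minimizer and from above at
        \<open>y\<close>. Dividing the comparison of the two by \<delta> yields the hypothesis of
        \<open>near_minimizer_of_quadratic\<close>.\<close>
      have "\<delta>\<^sup>2 * ((a / 2 - \<epsilon>) * (\<Sum>i\<in>UNIV. (v i)\<^sup>2)) = (\<Sum>i\<in>UNIV. (a / 2 - \<epsilon>) * (u i)\<^sup>2)"
        by (simp add: uv sum_distrib_left power_mult_distrib algebra_simps)
      also have "\<dots> \<le> (\<Sum>i\<in>UNIV. g (1 + u i))"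
      proof (rule sum_mono)
        fix i show "(a / 2 - \<epsilon>) * (u i)\<^sup>2 \<le> g (1 + u i)"
          using expand[OF ur[of i]] by (simp add: left_diff_distrib)
      qed
      finally have lower: "\<delta>\<^sup>2 * ((a / 2 - \<epsilon>) * (\<Sum>i\<in>UNIV. (v i)\<^sup>2)) \<le> (\<Sum>i\<in>UNIV. g (1 + u i))" .
      have "(\<Sum>i\<in>UNIV. g (1 + dev y i)) \<le> (\<Sum>i\<in>UNIV. (a / 2 + \<epsilon>) * (dev y i)\<^sup>2)"
      proof (rule sum_mono)
        fix i show "g (1 + dev y i) \<le> (a / 2 + \<epsilon>) * (dev y i)\<^sup>2"
          using expand[OF yr[of i]] by (simp add: distrib_right)
      qed
      also have "\<dots> = \<delta>\<^sup>2 * ((a / 2 + \<epsilon>) * S / a\<^sup>2)"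
        by (simp add: dev_y S_def sum_distrib_left sum_divide_distrib power_mult_distrib
            power_divide mult_ac)
      finally have upper: "(\<Sum>i\<in>UNIV. g (1 + dev y i)) \<le> \<delta>\<^sup>2 * ((a / 2 + \<epsilon>) * S / a\<^sup>2)" .
      have y_lin: "(\<Sum>i\<in>UNIV. dev y i * W i) = - \<delta> * (S / a)"
        by (simp add: dev_y S_def sum_distrib_left sum_divide_distrib power2_eq_square sum_negf
            mult_ac)
      have u_lin: "(\<Sum>i\<in>UNIV. u i * W i) = \<delta> * (\<Sum>i\<in>UNIV. v i * W i)"
        by (simp add: uv sum_distrib_left mult_ac)
      have scale: "1 / \<delta> * (\<delta>\<^sup>2 * t) = \<delta> * t" for t
        using \<delta> by (simp add: power2_eq_square)
      have "\<delta> * ((\<Sum>i\<in>UNIV. v i * W i) + (a / 2 - \<epsilon>) * (\<Sum>i\<in>UNIV. (v i)\<^sup>2))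
          \<le> (\<Sum>i\<in>UNIV. u i * W i) + 1 / \<delta> * (\<Sum>i\<in>UNIV. g (1 + u i))"
        using mult_left_mono[OF lower, of "1 / \<delta>"] \<delta>(1)
        unfolding scale u_lin by (simp add: distrib_left)
      also have "\<dots> \<le> (\<Sum>i\<in>UNIV. dev y i * W i) + 1 / \<delta> * (\<Sum>i\<in>UNIV. g (1 + dev y i))"
        using cmp by (simp add: u_def)
      also have "\<dots> \<le> - \<delta> * (S / a) + \<delta> * ((a / 2 + \<epsilon>) * S / a\<^sup>2)"
        using mult_left_mono[OF upper, of "1 / \<delta>"] \<delta>(1) unfolding scale y_lin by simp
      also have "\<dots> = \<delta> * (- S / (2 * a) + \<epsilon> * S / a\<^sup>2)"
        using a by (simp add: field_simps power2_eq_square)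
      finally have "(\<Sum>i\<in>UNIV. v i * W i) + (a / 2 - \<epsilon>) * (\<Sum>i\<in>UNIV. (v i)\<^sup>2)
          \<le> - S / (2 * a) + \<epsilon> * S / a\<^sup>2"
        using \<delta>(1) by (simp only: mult_le_cancel_left_pos)
      note near_minimizer_of_quadratic[OF a \<epsilon> this[unfolded S_def], folded S_def]
      moreover have "N * sensitivity_quotient Z Q \<delta> = (\<Sum>i\<in>UNIV. v i * W i)"
        using pv_expectation_deviation[OF opt(1)[OF \<delta>(1)], of Z] N \<delta>(1) u_lin
        by (simp add: sensitivity_quotient_def u_def dev_def N_def W_def m_def)
      ultimately show "(N * sensitivity_quotient Z Q \<delta> + S / a)\<^sup>2 \<le> 12 * \<epsilon> * S\<^sup>2 / a ^ 3"
        by simp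
    qed
  qed

  \<comment> \<open>Passage to the limit\<close>
  show ?thesis
  proof (rule tendstoI)
    fix \<eta> :: real assume \<eta>: "\<eta> > 0"
    define K where "K = 12 * S\<^sup>2 / a ^ 3"
    have K: "K \<ge> 0" using a by (simp add: K_def)
    \<comment> \<open>Chosen so that \<open>\<epsilon> * K < (N * \<eta>)^2\<close>; the denominator
      has \<open>K + 1\<close> because \<open>K\<close> is 0 for constant rewards.\<close>
    define \<epsilon> where "\<epsilon> = min (a / 8) ((N * \<eta>)\<^sup>2 / (2 * (K + 1)))"
    have \<epsilon>: "\<epsilon> > 0" using a \<eta> N K by (simp add: \<epsilon>_def)
    have "\<epsilon> \<le> a / 8" unfolding \<epsilon>_def by (rule min.cobounded1)
    have "\<epsilon> * K \<le> (N * \<eta>)\<^sup>2 / (2 * (K + 1)) * K"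
      using K by (intro mult_right_mono) (auto simp: \<epsilon>_def)
    also have "\<dots> < (N * \<eta>)\<^sup>2"
    proof -
      have "0 < (N * \<eta>)\<^sup>2" using N \<eta> by simp
      moreover have "K / (2 * (K + 1)) < 1" using K by simp
      ultimately have "(N * \<eta>)\<^sup>2 * (K / (2 * (K + 1))) < (N * \<eta>)\<^sup>2 * 1"
        by (rule mult_strict_left_mono[rotated])
      then show ?thesis by simp
    qed
    finally have lt: "12 * \<epsilon> * S\<^sup>2 / a ^ 3 < (N * \<eta>)\<^sup>2" by (simp add: K_def mult_ac)
    show "\<forall>\<^sub>F \<delta> in at_right 0. dist (sensitivity_quotient Z Q \<delta>)
        (- (1 / second_deriv \<phi> 1 * pv_variance empirical Z)) < \<eta>"
    proof (rule eventually_mono[OF key[OF \<epsilon> \<open>\<epsilon> \<le> a / 8\<close>]])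
      fix \<delta> assume "(N * sensitivity_quotient Z Q \<delta> + S / a)\<^sup>2 \<le> 12 * \<epsilon> * S\<^sup>2 / a ^ 3"
      then have "\<bar>N * sensitivity_quotient Z Q \<delta> + S / a\<bar>\<^sup>2 < (N * \<eta>)\<^sup>2" using lt by simp
      then have "\<bar>N * sensitivity_quotient Z Q \<delta> + S / a\<bar> < N * \<eta>"
        by (rule power2_less_imp_less) (use N \<eta> in simp)
      moreover have "N * sensitivity_quotient Z Q \<delta> + S / a
          = N * (sensitivity_quotient Z Q \<delta> + S / (a * N))"
        using N by (simp add: field_simps)
      ultimately show "dist (sensitivity_quotient Z Q \<delta>)
          (- (1 / second_deriv \<phi> 1 * pv_variance empirical Z)) < \<eta>"
        using N by (simp add: dist_real_def var abs_mult flip: a_def)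
    qed
  qed
qed

theorem theorem2p2:
  fixes \<phi> :: "real \<Rightarrow> ereal"
    and f :: "real ^ 'd \<Rightarrow> real ^ 'l \<Rightarrow> real"
    and x :: "real ^ 'd"
    and Y :: "'n::finite \<Rightarrow> real ^ 'l"
    and Q :: "real \<Rightarrow> real ^ 'n"
  assumes "closed_convex_fun \<phi>"
    and "\<forall>z\<ge>0. \<phi> z \<ge> \<phi> 1" and "\<phi> 1 = 0"
    and "\<forall>z<0. \<phi> z = \<infinity>"
    and "C2_around \<phi> 1"
    and "second_deriv \<phi> 1 > 0"
    and "worst_case_family \<phi> (\<lambda>i. f x (Y i)) Q"
  shows "(\<exists>L. (sensitivity_quotient (\<lambda>i. f x (Y i)) Q \<longlongrightarrow> L) (at_right 0))
    \<and> worst_case_sensitivity (\<lambda>i. f x (Y i)) Q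
        = 1 / second_deriv \<phi> 1 * pv_variance empirical (\<lambda>i. f x (Y i))"
proof -
  note lim = sensitivity_quotient_tendsto[OF assms]
  show ?thesis
    \<comment> \<open>The filter \<open>at_right 0\<close> is nontrivial, so \<open>Lim\<close> is
      the limit found, and the sign in the definition cancels its minus.\<close>
    unfolding worst_case_sensitivity_def tendsto_Lim[OF trivial_limit_at_right_real lim]
    using lim by auto
qed

end
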